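(* Let $K=\mathbb{F}_q$ be a finite field with $q$ elements. Let $\mathcal{C}$ be a clutter with vertex set $\{y_1,\ldots,y_n\}$ and with $s\geq 1$ edges, let $v_1,\ldots,v_s$ be the characteristic vectors of the edges of $\mathcal{C}$, and let $X\subset\mathbb{P}^{s-1}$ be the algebraic toric set parameterized by $y^{v_1},\ldots,y^{v_s}$. If the vanishing ideal $I(X)\subset S=K[t_1,\ldots,t_s]$ is a complete intersection, then $$ I(X)=(t_1^{q-1}-t_s^{q-1},\ldots,t_{s-1}^{q-1}-t_s^{q-1}). $$
   Context: A clutter $\mathcal{C}$ is a family $E$ of subsets (called edges) of a finite ground set $Y=\{y_1,\ldots,y_n\}$ (the vertex set) such that if $f_1,f_2\in E$ are distinct, then $f_1\not\subset f_2$. The characteristic vector of an edge $f$ is $\sum_{y_i\in f}e_i$, where $e_i$ is the $i$-th unit vector in $\mathbb{R}^n$; $v_1,\ldots,v_s$ is the list of the (distinct) characteristic vectors of all edges of $\mathcal{C}$, and $v_i=(v_{i1},\ldots,v_{in})\in\mathbb{N}^n$, where $\mathbb{N}$ includes $0$. With $K^*=K\setminus\{0\}$ and $\mathbb{P}^{s-1}$ the projective space of dimension $s-1$ over $K$, the algebraic toric set parameterized by $y^{v_1},\ldots,y^{v_s}$ is $$X=\{[(x_1^{v_{11}}\cdots x_n^{v_{1n}},\ldots,x_1^{v_{s1}}\cdots x_n^{v_{sn}})]\in\mathbb{P}^{s-1}\mid x_i\in K^*\text{ for all }i\}.$$ $S=K[t_1,\ldots,t_s]$ has the standard grading; $I(X)$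 is the ideal of $S$ generated by the homogeneous polynomials of $S$ that vanish on $X$. The ideal $I(X)$ is called a complete intersection if it can be generated by $s-1$ homogeneous polynomials of $S$. *)

theory Defs
  imports "HOL-Library.Poly_Mapping" "HOL-Library.FuncSet" "HOL-Library.Cardinality" "HOL-Algebra.Ideal"
begin

section \<open>Clutters\<close>

definition clutter :: "'y set \<Rightarrow> 'y set set \<Rightarrow> bool" where
  "clutter Y E \<longleftrightarrow> finite Y \<and> E \<subseteq> Pow Y \<and>
     (\<forall>f1\<in>E. \<forall>f2\<in>E. f1 \<noteq> f2 \<longrightarrow> \<not> f1 \<subset> f2)"

text \<open>A vector of length \<open>n\<close> is a function on \<open>nat\<close> whose coordinates are numbered \<open>1, \<dots>, n\<close>.
  The value outside this range is fixed, so that the vector is determined by its coordinates.\<close>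

definition char_vec :: "nat \<Rightarrow> (nat \<Rightarrow> 'y) \<Rightarrow> 'y set \<Rightarrow> nat \<Rightarrow> nat" where
  "char_vec n y f = (\<lambda>j\<in>{1..n}. if y j \<in> f then 1 else 0)"

section \<open>The polynomial ring \<open>K[t\<^sub>1, \<dots>, t\<^sub>s]\<close>\<close>

text \<open>A monomial is a finitely supported exponent function and a polynomial is a finitely
  supported coefficient function on monomials, with the convolution product of
  \<^theory>\<open>HOL-Library.Poly_Mapping\<close>. The ring \<open>K[t\<^sub>1, \<dots>, t\<^sub>s]\<close> consists of the polynomials
  in which only variables with index in \<open>{1..s}\<close> occur.\<close>

type_synonym 'k mpoly = "(nat \<Rightarrow>\<^sub>0 nat) \<Rightarrow>\<^sub>0 'k"

definition poly_ring :: "nat \<Rightarrow> 'k::comm_ring_1 mpoly ring" where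
  "poly_ring s = \<lparr>carrier = {p. \<forall>m\<in>Poly_Mapping.keys p. Poly_Mapping.keys m \<subseteq> {1..s}},
     monoid.mult = (*), one = 1, zero = 0, add = (+)\<rparr>"

definition var :: "nat \<Rightarrow> 'k::comm_ring_1 mpoly" where
  "var i = Poly_Mapping.single (Poly_Mapping.single i 1) 1"

definition eval :: "'k::comm_ring_1 mpoly \<Rightarrow> (nat \<Rightarrow> 'k) \<Rightarrow> 'k" where
  "eval p x = (\<Sum>m\<in>Poly_Mapping.keys p. Poly_Mapping.lookup p m * (\<Prod>i\<in>Poly_Mapping.keys m. x i ^ Poly_Mapping.lookup m i))"

definition homogeneous :: "'k::comm_ring_1 mpoly \<Rightarrow> bool" where
  "homogeneous p \<longleftrightarrow> (\<exists>d. \<forall>m\<in>Poly_Mapping.keys p. (\<Sum>i\<in>Poly_Mapping.keys m. Poly_Mapping.lookup m i) = d)"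

lemma cring_poly_ring: "cring (poly_ring s :: 'k::comm_ring_1 mpoly ring)"
proof (rule cringI)
  show "abelian_group (poly_ring s :: 'k mpoly ring)"
  proof (rule abelian_groupI)
    fix x y :: "'k mpoly"
    assume "x \<in> carrier (poly_ring s)" "y \<in> carrier (poly_ring s)"
    then show "x \<oplus>\<^bsub>poly_ring s\<^esub> y \<in> carrier (poly_ring s)"
      using keys_add[of x y] by (auto simp: poly_ring_def)
  next
    fix x :: "'k mpoly"
    assume "x \<in> carrier (poly_ring s)"
    then show "\<exists>y\<in>carrier (poly_ring s). y \<oplus>\<^bsub>poly_ring s\<^esub> x = \<zero>\<^bsub>poly_ring s\<^esub>"
      by (intro bexI[of _ "- x"]) (auto simp: poly_ring_def)
  qed (auto simp: poly_ring_def add_ac)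
  show "comm_monoid (poly_ring s :: 'k mpoly ring)"
  proof (rule comm_monoidI)
    fix x y :: "'k mpoly"
    assume xy: "x \<in> carrier (poly_ring s)" "y \<in> carrier (poly_ring s)"
    have "Poly_Mapping.keys m \<subseteq> {1..s}" if m: "m \<in> Poly_Mapping.keys (x * y)" for m
    proof -
      obtain a b where "m = a + b" "a \<in> Poly_Mapping.keys x" "b \<in> Poly_Mapping.keys y"
        using m keys_mult[of x y] by blast
      moreover have "Poly_Mapping.keys a \<subseteq> {1..s}" "Poly_Mapping.keys b \<subseteq> {1..s}"
        using xy \<open>a \<in> _\<close> \<open>b \<in> _\<close> by (simp_all add: poly_ring_def)
      ultimately show ?thesis
        using keys_add[of a b] by blast
    qed
    then show "x \<otimes>\<^bsub>poly_ring s\<^esub> y \<in> carrier (poly_ring s)"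
      by (simp add: poly_ring_def)
  qed (auto simp: poly_ring_def mult_ac)
qed (auto simp: poly_ring_def distrib_right)

section \<open>Projective space and vanishing ideals\<close>

text \<open>A projective point is an equivalence class of nonzero vectors of \<open>K\<^sup>s\<close> up to nonzero scalars.\<close>

definition nonzero_vecs :: "nat \<Rightarrow> (nat \<Rightarrow> 'k::field) set" where
  "nonzero_vecs s = {a \<in> {1..s} \<rightarrow>\<^sub>E UNIV. \<exists>i\<in>{1..s}. a i \<noteq> 0}"

definition proj_rel :: "nat \<Rightarrow> ((nat \<Rightarrow> 'k::field) \<times> (nat \<Rightarrow> 'k)) set" where
  "proj_rel s = {(a, b). a \<in> nonzero_vecs s \<and> b \<in> nonzero_vecs s \<and>
     (\<exists>c. c \<noteq> 0 \<and> (\<forall>i\<in>{1..s}. b i = c * a i))}"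

definition proj_space :: "nat \<Rightarrow> (nat \<Rightarrow> 'k::field) set set" where
  "proj_space s = nonzero_vecs s // proj_rel s"

definition proj_point :: "nat \<Rightarrow> (nat \<Rightarrow> 'k::field) \<Rightarrow> (nat \<Rightarrow> 'k) set" where
  "proj_point s a = proj_rel s `` {\<lambda>i\<in>{1..s}. a i}"

definition toric_set :: "nat \<Rightarrow> nat \<Rightarrow> (nat \<Rightarrow> nat \<Rightarrow> nat) \<Rightarrow> (nat \<Rightarrow> 'k::field) set set" where
  "toric_set n s v =
     {proj_point s (\<lambda>i. \<Prod>j=1..n. x j ^ v i j) | x. \<forall>j\<in>{1..n}. x j \<noteq> 0}"

definition vanishing_ideal :: "nat \<Rightarrow> (nat \<Rightarrow> 'k::field) set set \<Rightarrow> 'k mpoly set" where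
  "vanishing_ideal s X = genideal (poly_ring s)
     {f \<in> carrier (poly_ring s). homogeneous f \<and> (\<forall>P\<in>X. \<forall>a\<in>P. eval f a = 0)}"

text \<open>The ideal of a set of points in \<open>s - 1\<close> dimensional projective space is a complete
  intersection. The \<open>s - 1\<close> generators are allowed to coincide or to be zero.\<close>

definition complete_intersection :: "nat \<Rightarrow> 'k::field mpoly set \<Rightarrow> bool" where
  "complete_intersection s I \<longleftrightarrow>
     (\<exists>g. (\<forall>i\<in>{1..s-1}. g i \<in> carrier (poly_ring s) \<and> homogeneous (g i)) \<and>
          I = genideal (poly_ring s) (g ` {1..s-1}))"

lemma equiv_proj_rel: "equiv (nonzero_vecs s :: (nat \<Rightarrow> 'k::field) set) (proj_rel s :: ((nat \<Rightarrow> 'k) \<times> _) set)"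
proof (intro equivI)
  show "(proj_rel s :: ((nat \<Rightarrow> 'k) \<times> _) set) \<subseteq> nonzero_vecs s \<times> nonzero_vecs s"
    by (auto simp: proj_rel_def)
  show "refl_on (nonzero_vecs s) (proj_rel s :: ((nat \<Rightarrow> 'k) \<times> _) set)"
  proof (rule refl_onI)
    fix a :: "nat \<Rightarrow> 'k"
    assume "a \<in> nonzero_vecs s"
    moreover have "\<exists>c::'k. c \<noteq> 0 \<and> (\<forall>i\<in>{1..s}. a i = c * a i)"
      by (rule exI[of _ 1]) simp
    ultimately show "(a, a) \<in> proj_rel s"
      by (simp add: proj_rel_def)
  qed
  show "sym (proj_rel s :: ((nat \<Rightarrow> 'k) \<times> _) set)"
  proof (rule symI)
    fix a b :: "nat \<Rightarrow> 'k"
    assume *: "(a, b) \<in> proj_rel s"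
    then obtain c where "c \<noteq> 0" "\<forall>i\<in>{1..s}. b i = c * a i"
      by (auto simp: proj_rel_def)
    then show "(b, a) \<in> proj_rel s"
      using * by (auto simp: proj_rel_def intro!: exI[of _ "inverse c"])
  qed
  show "trans (proj_rel s :: ((nat \<Rightarrow> 'k) \<times> _) set)"
  proof (rule transI)
    fix a b d :: "nat \<Rightarrow> 'k"
    assume *: "(a, b) \<in> proj_rel s" "(b, d) \<in> proj_rel s"
    then obtain c c' where "c \<noteq> 0" "\<forall>i\<in>{1..s}. b i = c * a i"
      "c' \<noteq> 0" "\<forall>i\<in>{1..s}. d i = c' * b i"
      by (auto simp: proj_rel_def)
    then show "(a, d) \<in> proj_rel s"
      using * by (auto simp: proj_rel_def intro!: exI[of _ "c' * c"])
  qed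
qed

lemma toric_set_subset_proj_space:
  assumes "s \<ge> 1"
  shows "(toric_set n s v :: (nat \<Rightarrow> 'k::field) set set) \<subseteq> proj_space s"
proof
  fix P :: "(nat \<Rightarrow> 'k) set"
  assume "P \<in> toric_set n s v"
  then obtain x where x: "\<forall>j\<in>{1..n}. x j \<noteq> 0"
    and P: "P = proj_point s (\<lambda>i. \<Prod>j=1..n. x j ^ v i j)"
    by (auto simp: toric_set_def)
  have "(\<lambda>i\<in>{1..s}. \<Prod>j=1..n. x j ^ v i j) \<in> nonzero_vecs s"
    using x assms by (auto simp: nonzero_vecs_def intro!: bexI[of _ 1])
  then show "P \<in> proj_space s"
    by (simp add: P proj_point_def proj_space_def quotientI)
qed

end

theory Submission
  imports "Jordan_Normal_Form.Determinant" Defs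
begin

text \<open>
  Write \<open>N = q - 1\<close> and \<open>h\<^sub>i = t\<^sub>i\<^sup>N - t\<^sub>s\<^sup>N\<close> for \<open>i < s\<close>, and let \<open>g\<^sub>1, \<dots>, g\<^bsub>s-1\<^esub>\<close> be homogeneous
  generators of \<open>I(X)\<close>. Every \<open>h\<^sub>i\<close> lies in \<open>I(X)\<close>, because the coordinates of a point of \<open>X\<close> are
  nonzero and nonzero elements of \<open>K\<close> have \<open>N\<close>-th power 1. The point is to express the \<open>g\<^sub>k\<close> by
  the \<open>h\<^sub>i\<close>, and this is done by looking only at the coefficients of pure powers of the variables.

  A homogeneous \<open>f \<in> I(X)\<close> of degree \<open>d < N\<close> contains no pure power \<open>t\<^sub>j\<^sup>d\<close>
  (\<open>no_pure_power_low_degree\<close>). Substituting \<open>t\<^sub>i = y^v\<^sub>i\<close> turns \<open>f\<close> into a polynomial that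
  vanishes on the torus \<open>(K\<^sup>*)\<^sup>n\<close>. As the \<open>v\<^sub>i\<close> are 0-1-vectors, it has degree at most
  \<open>d < N\<close> in every \<open>y\<^sub>k\<close>, so it is the zero polynomial. The power \<open>t\<^sub>j\<^sup>d\<close> goes to the monomial with
  exponent vector \<open>d v\<^sub>j\<close>, and no other monomial of degree \<open>d\<close> does: a sum of \<open>d\<close> 0-1-vectors equals
  \<open>d v\<^sub>j\<close> only if all of them are \<open>v\<^sub>j\<close>. So nothing can cancel the coefficient of \<open>t\<^sub>j\<^sup>d\<close>.

  Now write \<open>h\<^sub>i = \<Sum>\<^sub>k a\<^sub>i\<^sub>k g\<^sub>k\<close> and compare coefficients at \<open>t\<^sub>j\<^sup>N\<close> for \<open>j < s\<close>. On the left is the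
  identity matrix. On the right only those \<open>k\<close> count for which \<open>g\<^sub>k\<close> has degree exactly \<open>N\<close>: a
  larger degree cannot contribute, and a smaller one would need a pure power in \<open>g\<^sub>k\<close>. Hence
  \<open>A G = 1\<close>, where \<open>A\<close> collects the constant coefficients of the \<open>a\<^sub>i\<^sub>k\<close> and \<open>G\<close> the coefficients
  of \<open>g\<^sub>k\<close> at \<open>t\<^sub>j\<^sup>N\<close>. Here the complete intersection hypothesis enters: there are as many
  generators as \<open>h\<close>'s, the matrices are square, and \<open>G A = 1\<close> as well. Therefore \<open>G\<close> has no zero row, so
  all \<open>g\<^sub>k\<close> have degree \<open>N\<close>. In degree \<open>N\<close> the expansion of \<open>h\<^sub>i\<close> then reads
  \<open>h\<^sub>i = \<Sum>\<^sub>k A\<^sub>i\<^sub>k g\<^sub>k\<close>, and \<open>G A = 1\<close> inverts it to \<open>g\<^sub>k = \<Sum>\<^sub>i G\<^sub>k\<^sub>i h\<^sub>i\<close>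
  (\<open>generators_in_ideal_of_dual_family\<close>).
\<close>

section \<open>Ideals of the polynomial ring\<close>

abbreviation poly_carrier :: "nat \<Rightarrow> 'k::comm_ring_1 mpoly set" where
  "poly_carrier s \<equiv> carrier (poly_ring s)"

lemma poly_carrier_iff:
  "p \<in> poly_carrier s \<longleftrightarrow> (\<forall>m\<in>Poly_Mapping.keys p. Poly_Mapping.keys m \<subseteq> {1..s})"
  by (simp add: poly_ring_def)

lemma poly_ring_ops [simp]:
  "mult (poly_ring s) = (*)" "add (poly_ring s) = (+)"
  "zero (poly_ring s) = 0" "one (poly_ring s) = 1"
  by (simp_all add: poly_ring_def)

lemma poly_carrier_mult: "p \<in> poly_carrier s \<Longrightarrow> r \<in> poly_carrier s \<Longrightarrow> p * r \<in> poly_carrier s"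
  using monoid.m_closed[of "poly_ring s" p r] cring_poly_ring[of s, where ?'k = 'a]
  by (simp add: cring_def comm_monoid_def)

lemma poly_carrier_add: "p \<in> poly_carrier s \<Longrightarrow> r \<in> poly_carrier s \<Longrightarrow> p + r \<in> poly_carrier s"
  using keys_add[of p r] by (auto simp: poly_carrier_iff)

lemma poly_carrier_const: "Poly_Mapping.single 0 c \<in> poly_carrier s"
  by (simp add: poly_carrier_iff)

lemma poly_carrier_zero: "0 \<in> poly_carrier s"
  by (simp add: poly_carrier_iff)

lemma poly_carrier_sum:
  "(\<And>k. k \<in> A \<Longrightarrow> p k \<in> poly_carrier s) \<Longrightarrow> (\<Sum>k\<in>A. p k) \<in> poly_carrier s"
  by (induction A rule: infinite_finite_induct) (auto intro: poly_carrier_add poly_carrier_zero)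

text \<open>Negatives come for free, since \<open>- 1\<close> is a constant of the ring.\<close>

lemma poly_ring_idealI:
  fixes I :: "'k::comm_ring_1 mpoly set"
  assumes "I \<subseteq> poly_carrier s" "0 \<in> I"
    and add: "\<And>p r. p \<in> I \<Longrightarrow> r \<in> I \<Longrightarrow> p + r \<in> I"
    and mult: "\<And>p r. p \<in> poly_carrier s \<Longrightarrow> r \<in> I \<Longrightarrow> p * r \<in> I"
  shows "ideal I (poly_ring s)"
proof -
  interpret R: cring "poly_ring s :: 'k mpoly ring" by (rule cring_poly_ring)
  have neg: "- x \<in> I" if "x \<in> I" for x
    using mult[OF poly_carrier_const[of "-1"] that] by (simp add: single_uminus)
  have inv: "\<ominus>\<^bsub>poly_ring s\<^esub> x = - x" if "x \<in> I" for x
    using that neg assms(1) by (intro R.minus_equality) auto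
  show ?thesis
  proof (rule idealI)
    show "ring (poly_ring s :: 'k mpoly ring)" by (rule R.ring_axioms)
    show "subgroup I (add_monoid (poly_ring s))"
    proof (rule R.add.subgroupI)
      show "\<ominus>\<^bsub>poly_ring s\<^esub> a \<in> I" if "a \<in> I" for a
        using neg[OF that] inv[OF that] by simp
    qed (use assms add in auto)
    show "a \<otimes>\<^bsub>poly_ring s\<^esub> x \<in> I" if "a \<in> I" "x \<in> poly_carrier s" for a x
      using mult[OF that(2,1)] by (simp add: mult.commute)
  qed (use mult in auto)
qed

lemma genideal_minimal_poly:
  fixes I :: "'k::comm_ring_1 mpoly set"
  assumes "ideal I (poly_ring s)" "G \<subseteq> I"
  shows "genideal (poly_ring s) G \<subseteq> I"
  using ring.genideal_minimal[of "poly_ring s" I G] cring_poly_ring[of s, where ?'k = 'k] assms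
  by (simp add: cring_def)

lemma ideal_genideal_poly:
  fixes G :: "'k::comm_ring_1 mpoly set"
  assumes "G \<subseteq> poly_carrier s"
  shows "ideal (genideal (poly_ring s) G) (poly_ring s)" "G \<subseteq> genideal (poly_ring s) G"
  using ring.genideal_ideal[of "poly_ring s" G] ring.genideal_self[of "poly_ring s" G]
    cring_poly_ring[of s, where ?'k = 'k] assms
  by (simp_all add: cring_def)

lemma ideal_combination_closed:
  fixes I :: "'k::comm_ring_1 mpoly set"
  assumes "ideal I (poly_ring s)" "\<And>k. k \<in> A \<Longrightarrow> a k \<in> poly_carrier s" "\<And>k. k \<in> A \<Longrightarrow> g k \<in> I"
  shows "(\<Sum>k\<in>A. a k * g k) \<in> I"
proof -
  interpret ideal I "poly_ring s" by fact
  show ?thesis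
    using assms(2,3)
  proof (induction A rule: infinite_finite_induct)
    case (insert k A)
    then show ?case
      using additive_subgroup.a_closed[OF additive_subgroup_axioms, of "a k * g k" "\<Sum>k\<in>A. a k * g k"] I_l_closed[of "g k" "a k"] by simp
  qed (use additive_subgroup.zero_closed[OF additive_subgroup_axioms] in auto)
qed

text \<open>The combinations of the generators form an ideal, which contains the generated one by
  minimality. This is what gives access to the cofactors of an ideal element.\<close>

lemma genideal_image_combination:
  fixes g :: "nat \<Rightarrow> 'k::comm_ring_1 mpoly"
  assumes "finite A" "g ` A \<subseteq> poly_carrier s" "p \<in> genideal (poly_ring s) (g ` A)"
  obtains a where "\<And>k. k \<in> A \<Longrightarrow> a k \<in> poly_carrier s" "p = (\<Sum>k\<in>A. a k * g k)"
proof -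
  define I where "I = {\<Sum>k\<in>A. a k * g k | a. \<forall>k\<in>A. a k \<in> poly_carrier s}"
  have "ideal I (poly_ring s)"
  proof (rule poly_ring_idealI)
    show "I \<subseteq> poly_carrier s"
      using assms(2) by (auto simp: I_def intro!: poly_carrier_sum poly_carrier_mult)
    show "0 \<in> I"
      by (auto simp: I_def poly_carrier_zero intro!: exI[of _ "\<lambda>_. 0"])
  next
    fix p r :: "'k mpoly" assume "p \<in> I" "r \<in> I"
    then obtain a b where "\<forall>k\<in>A. a k \<in> poly_carrier s" "p = (\<Sum>k\<in>A. a k * g k)"
      "\<forall>k\<in>A. b k \<in> poly_carrier s" "r = (\<Sum>k\<in>A. b k * g k)"
      by (auto simp: I_def)
    then show "p + r \<in> I"
      unfolding I_def
      by (auto simp: sum.distrib distrib_right poly_carrier_add intro!: exI[of _ "\<lambda>k. a k + b k"])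
  next
    fix p r :: "'k mpoly" assume "p \<in> poly_carrier s" "r \<in> I"
    moreover from this obtain b where "\<forall>k\<in>A. b k \<in> poly_carrier s" "r = (\<Sum>k\<in>A. b k * g k)"
      by (auto simp: I_def)
    ultimately show "p * r \<in> I"
      unfolding I_def
      by (auto simp: sum_distrib_left mult.assoc poly_carrier_mult intro!: exI[of _ "\<lambda>k. p * b k"])
  qed
  moreover have "g ` A \<subseteq> I"
  proof
    fix x assume "x \<in> g ` A"
    then obtain k where k: "k \<in> A" "x = g k" by blast
    have "x = (\<Sum>l\<in>A. (if l = k then 1 else 0) * g l)"
      using k assms(1) by (simp add: if_distrib[of "\<lambda>z. z * _"] sum.delta cong: if_cong)
    moreover have "\<forall>l\<in>A. (if l = k then 1 else 0 :: 'k mpoly) \<in> poly_carrier s"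
      using poly_carrier_const[of "1::'k" s] by (auto simp: poly_carrier_zero)
    ultimately show "x \<in> I"
      unfolding I_def by (intro CollectI exI[of _ "\<lambda>l. if l = k then 1 else 0"] conjI)
  qed
  ultimately have "p \<in> I"
    using genideal_minimal_poly assms(3) by blast
  then show ?thesis using that by (auto simp: I_def)
qed

section \<open>Evaluation is a ring homomorphism\<close>

text \<open>The value of a monomial at a point, split off from \<^const>\<open>eval\<close> because its
  multiplicativity is what makes evaluation multiplicative.\<close>

definition monom_eval :: "(nat \<Rightarrow>\<^sub>0 nat) \<Rightarrow> (nat \<Rightarrow> 'k::comm_ring_1) \<Rightarrow> 'k" where
  "monom_eval m x = (\<Prod>i\<in>Poly_Mapping.keys m. x i ^ Poly_Mapping.lookup m i)"

lemma monom_eval_superset: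
  assumes "finite A" "Poly_Mapping.keys m \<subseteq> A"
  shows "monom_eval m x = (\<Prod>i\<in>A. x i ^ Poly_Mapping.lookup m i)"
  unfolding monom_eval_def using assms
  by (intro prod.mono_neutral_left) (auto simp: in_keys_iff)

lemma monom_eval_add: "monom_eval (a + b) x = monom_eval a x * monom_eval b x"
proof -
  let ?A = "Poly_Mapping.keys a \<union> Poly_Mapping.keys b"
  show ?thesis
    using keys_add[of a b]
    by (simp add: monom_eval_superset[of ?A] lookup_add power_add prod.distrib)
qed

lemma eval_eq: "eval p x = (\<Sum>m\<in>Poly_Mapping.keys p. Poly_Mapping.lookup p m * monom_eval m x)"
  by (simp add: eval_def monom_eval_def)

lemma eval_zero [simp]: "eval 0 x = 0"
  by (simp add: eval_eq)

lemma eval_single: "eval (Poly_Mapping.single m c) x = c * monom_eval m x"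
  by (simp add: eval_eq)

lemma eval_add: "eval (p + r) x = eval p x + eval r x"
  unfolding eval_eq by (rule setsum_keys_plus_distrib) (auto simp: distrib_right)

lemma eval_sum: "eval (\<Sum>k\<in>A. p k) x = (\<Sum>k\<in>A. eval (p k) x)"
  by (induction A rule: infinite_finite_induct) (auto simp: eval_add)

lemma poly_mapping_sum_singles:
  "p = (\<Sum>m\<in>Poly_Mapping.keys p. Poly_Mapping.single m (Poly_Mapping.lookup p m))"
  by (rule poly_mapping_eqI)
    (auto simp: lookup_sum lookup_single when_def sum.delta in_keys_iff)

lemma eval_mult:
  fixes p r :: "'k::comm_ring_1 mpoly"
  shows "eval (p * r) x = eval p x * eval r x"
proof -
  have "p * r = (\<Sum>m\<in>Poly_Mapping.keys p. Poly_Mapping.single m (Poly_Mapping.lookup p m)) *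
      (\<Sum>l\<in>Poly_Mapping.keys r. Poly_Mapping.single l (Poly_Mapping.lookup r l))"
    by (rule arg_cong2[OF poly_mapping_sum_singles poly_mapping_sum_singles])
  also have "\<dots> = (\<Sum>m\<in>Poly_Mapping.keys p. \<Sum>l\<in>Poly_Mapping.keys r.
      Poly_Mapping.single (m + l) (Poly_Mapping.lookup p m * Poly_Mapping.lookup r l))"
    by (simp add: sum_product mult_single)
  finally show ?thesis
    by (simp add: eval_sum eval_single monom_eval_add eval_eq[of p] eval_eq[of r] sum_product mult_ac)
qed

lemma eval_cong:
  assumes "p \<in> poly_carrier s" "\<And>i. i \<in> {1..s} \<Longrightarrow> x i = z i"
  shows "eval p x = eval p z"
  using assms unfolding eval_def poly_carrier_iff
  by (intro sum.cong arg_cong2[where f = "(*)"] prod.cong) (auto dest!: bspec)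

section \<open>Degrees and coefficients of products\<close>

definition mdeg :: "(nat \<Rightarrow>\<^sub>0 nat) \<Rightarrow> nat" where
  "mdeg m = (\<Sum>i\<in>Poly_Mapping.keys m. Poly_Mapping.lookup m i)"

lemma mdeg_add: "mdeg (a + b) = mdeg a + mdeg b"
  unfolding mdeg_def by (rule setsum_keys_plus_distrib) auto

lemma mdeg_single [simp]: "mdeg (Poly_Mapping.single i d) = d"
  by (simp add: mdeg_def)

lemma mdeg_eq_0_iff: "mdeg m = 0 \<longleftrightarrow> m = 0"
  by (auto simp: mdeg_def in_keys_iff intro: poly_mapping_eqI)

text \<open>The zero polynomial has every degree.\<close>

definition hom_deg :: "nat \<Rightarrow> 'k::zero mpoly \<Rightarrow> bool" where
  "hom_deg d p \<longleftrightarrow> (\<forall>m\<in>Poly_Mapping.keys p. mdeg m = d)"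

lemma homogeneous_iff_hom_deg: "homogeneous p \<longleftrightarrow> (\<exists>d. hom_deg d p)"
  by (simp add: homogeneous_def hom_deg_def mdeg_def)

lemma lookup_const_mult:
  "Poly_Mapping.lookup (Poly_Mapping.single 0 c * p) m = c * Poly_Mapping.lookup p m"
  by (simp add: Poly_Mapping.map.rep_eq when_def flip: mult_map_scale_conv_mult)

lemma lookup_mult_low_degree:
  fixes a g :: "'k::comm_ring_1 mpoly"
  assumes "hom_deg d g" "mdeg m < d"
  shows "Poly_Mapping.lookup (a * g) m = 0"
proof (rule ccontr)
  assume "\<not> ?thesis"
  then obtain u w where "m = u + w" "w \<in> Poly_Mapping.keys g"
    using keys_mult[of a g] by (auto simp: in_keys_iff)
  then show False
    using assms by (auto simp: hom_deg_def mdeg_add)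
qed

text \<open>If \<open>g\<close> has degree \<open>d\<close>, then a product term of degree \<open>d\<close> pairs a term of \<open>g\<close> with a term of
  degree 0 of \<open>a\<close>. The proof subtracts the constant term from \<open>a\<close>, after which no such pair is left.\<close>

lemma lookup_mult_same_degree:
  fixes a g :: "'k::comm_ring_1 mpoly"
  assumes "hom_deg d g" "mdeg m = d"
  shows "Poly_Mapping.lookup (a * g) m = Poly_Mapping.lookup a 0 * Poly_Mapping.lookup g m"
proof -
  define c :: "'k mpoly" where "c = Poly_Mapping.single 0 (Poly_Mapping.lookup a 0)"
  have "Poly_Mapping.lookup ((a - c) * g) m = 0"
  proof (rule ccontr)
    assume "\<not> ?thesis"
    then obtain u w where uw: "m = u + w" "u \<in> Poly_Mapping.keys (a - c)" "w \<in> Poly_Mapping.keys g"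
      using keys_mult[of "a - c" g] by (auto simp: in_keys_iff)
    then have "mdeg u = 0"
      using assms by (auto simp: hom_deg_def mdeg_add)
    then show False
      using uw(2) by (simp add: mdeg_eq_0_iff in_keys_iff c_def lookup_minus)
  qed
  then show ?thesis
    by (simp add: left_diff_distrib lookup_minus c_def lookup_const_mult)
qed

text \<open>Every divisor of a power of \<open>t\<^sub>j\<close> is again a power of \<open>t\<^sub>j\<close>, so one can occur in a product
  only if each factor contains some power of \<open>t\<^sub>j\<close>.\<close>

lemma lookup_mult_pure_power:
  fixes a g :: "'k::comm_ring_1 mpoly"
  assumes "hom_deg d g" "Poly_Mapping.lookup g (Poly_Mapping.single j d) = 0"
  shows "Poly_Mapping.lookup (a * g) (Poly_Mapping.single j N) = 0"
proof (rule ccontr)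
  assume "\<not> ?thesis"
  then obtain u w where uw: "Poly_Mapping.single j N = u + w" "w \<in> Poly_Mapping.keys g"
    using keys_mult[of a g] by (force simp: in_keys_iff)
  have "Poly_Mapping.lookup w i = 0" if "i \<noteq> j" for i
    using arg_cong[OF uw(1), of "\<lambda>p. Poly_Mapping.lookup p i"] that
    by (simp add: lookup_add lookup_single)
  then have "w = Poly_Mapping.single j (Poly_Mapping.lookup w j)"
    by (intro poly_mapping_eqI) (auto simp: lookup_single when_def)
  moreover have "mdeg w = d"
    using uw(2) assms(1) by (simp add: hom_deg_def)
  ultimately have "w = Poly_Mapping.single j d"
    by (metis mdeg_single)
  then show False
    using uw(2) assms(2) by (simp add: in_keys_iff)
qed

section \<open>Pure powers in the vanishing ideal\<close>

text \<open>Multiplication by \<open>x\<close> permutes the nonzero elements; compare the product of all of them before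
  and after.\<close>

lemma finite_field_power_eq_1:
  fixes x :: "'k::{field,finite}"
  assumes "x \<noteq> 0"
  shows "x ^ (CARD('k) - 1) = 1"
proof -
  let ?U = "UNIV - {0::'k}"
  have bij: "bij_betw ((*) x) ?U ?U"
    by (rule bij_betwI[where g = "\<lambda>z. z / x"]) (use assms in auto)
  have "(\<Prod>z\<in>?U. z) = (\<Prod>z\<in>?U. x * z)"
    using prod.reindex_bij_betw[OF bij, of "\<lambda>z. z"] by simp
  also have "\<dots> = x ^ (CARD('k) - 1) * (\<Prod>z\<in>?U. z)"
    by (simp add: prod.distrib card_Diff_subset)
  finally show ?thesis
    by simp
qed

text \<open>A polynomial of degree less than \<open>q - 1\<close> in each variable that vanishes on \<open>(K\<^sup>*)\<^sup>n\<close> has only zero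
  coefficients. It is given as a sum over an index set \<open>M\<close> in which several indices may have the
  same exponent vector, so the coefficient at \<open>w\<close> is the sum over the indices with exponents \<open>w\<close>:
  this is the shape in which it arises from substituting monomials into another polynomial.\<close>

lemma reduced_polynomial_vanishing_on_torus:
  fixes c :: "'a \<Rightarrow> 'k::{field,finite}" and e :: "'a \<Rightarrow> nat \<Rightarrow> nat"
  assumes "finite M" and "\<And>m k. m \<in> M \<Longrightarrow> k \<in> {1..n} \<Longrightarrow> e m k < CARD('k) - 1"
    and "\<And>x. \<forall>k\<in>{1..n}. x k \<noteq> 0 \<Longrightarrow> (\<Sum>m\<in>M. c m * (\<Prod>k=1..n. x k ^ e m k)) = 0"
  shows "(\<Sum>m | m \<in> M \<and> (\<forall>k\<in>{1..n}. e m k = w k). c m) = 0"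
  using assms
proof (induction n arbitrary: M)
  case 0
  from 0(3)[of "\<lambda>_. 1"] show ?case by simp
next
  case (Suc n)
  define M' where "M' = {m \<in> M. e m (Suc n) = w (Suc n)}"
  have "(\<Sum>m\<in>M'. c m * (\<Prod>k=1..n. x k ^ e m k)) = 0" if x: "\<forall>k\<in>{1..n}. x k \<noteq> 0" for x
  proof -
    \<comment> \<open>The polynomial in the last variable that remains when the first \<open>n\<close> variables are fixed. It has
      more roots than its degree, so each of its coefficients vanishes at \<open>x\<close>.\<close>
    define P where "P = (\<Sum>m\<in>M. Polynomial.monom (c m * (\<Prod>k=1..n. x k ^ e m k)) (e m (Suc n)))"
    have root: "poly P z = 0" if z: "z \<noteq> 0" for z
    proof -
      have "poly P z = (\<Sum>m\<in>M. c m * (\<Prod>k=1..Suc n. (x(Suc n := z)) k ^ e m k))"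
        by (simp add: P_def poly_sum poly_monom mult_ac)
      also have "\<dots> = 0"
        using x z by (intro Suc.prems(3)) auto
      finally show ?thesis .
    qed
    have "P = 0"
    proof (rule ccontr)
      assume P0: "P \<noteq> 0"
      have "degree P < CARD('k) - 1"
      proof (cases "M = {}")
        case False
        then obtain m where "m \<in> M" by blast
        then have "0 < CARD('k) - 1"
          using Suc.prems(2)[of m "Suc n"] by simp
        then show ?thesis
          unfolding P_def
          using Suc.prems(1,2) by (intro degree_sum_less) (auto intro: le_less_trans[OF degree_monom_le])
      qed (use P0 in \<open>simp add: P_def\<close>)
      moreover have "CARD('k) - 1 \<le> card {z. poly P z = 0}"
        using root card_mono[of "{z. poly P z = 0}" "UNIV - {0::'k}"]
        by (auto simp: card_Diff_subset)
      ultimately show False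
        using card_poly_roots_bound[OF P0] by simp
    qed
    then have "0 = coeff P (w (Suc n))" by simp
    also have "\<dots> = (\<Sum>m\<in>M'. c m * (\<Prod>k=1..n. x k ^ e m k))"
      using Suc.prems(1) unfolding P_def M'_def
      by (simp add: coeff_sum sum.inter_filter if_distrib cong: if_cong)
    finally show ?thesis by simp
  qed
  moreover have "e m k < CARD('k) - 1" if "m \<in> M'" "k \<in> {1..n}" for m k
    using that Suc.prems(2) by (auto simp: M'_def)
  moreover have "finite M'" using Suc.prems(1) by (simp add: M'_def)
  ultimately have "(\<Sum>m | m \<in> M' \<and> (\<forall>k\<in>{1..n}. e m k = w k). c m) = 0"
    by (intro Suc.IH) auto
  moreover have "{m. m \<in> M' \<and> (\<forall>k\<in>{1..n}. e m k = w k)} =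
      {m. m \<in> M \<and> (\<forall>k\<in>{1..Suc n}. e m k = w k)}"
    by (auto simp: M'_def le_Suc_eq)
  ultimately show ?case by simp
qed

text \<open>Under the parameterization \<open>t\<^sub>i = y^v\<^sub>i\<close> by distinct 0-1-vectors, \<open>t\<^sub>j\<^sup>d\<close> is the only monomial of
  degree \<open>d\<close> that is sent to \<open>y^(d v\<^sub>j)\<close>. The bound \<open>d < q - 1\<close> makes the substituted polynomial
  reduced, so its coefficient at this monomial, which is the coefficient of \<open>t\<^sub>j\<^sup>d\<close> in \<open>f\<close>, is zero.\<close>

lemma no_pure_power_low_degree:
  fixes f :: "'k::{field,finite} mpoly" and v :: "nat \<Rightarrow> nat \<Rightarrow> nat"
  assumes f: "f \<in> poly_carrier s" "hom_deg d f" and d: "d < CARD('k) - 1"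
    and v01: "\<And>i k. i \<in> {1..s} \<Longrightarrow> k \<in> {1..n} \<Longrightarrow> v i k \<le> 1"
    and v_inj: "\<And>i j. i \<in> {1..s} \<Longrightarrow> j \<in> {1..s} \<Longrightarrow> \<forall>k\<in>{1..n}. v i k = v j k \<Longrightarrow> i = j"
    and vanish: "\<And>x. \<forall>k\<in>{1..n}. x k \<noteq> 0 \<Longrightarrow> eval f (\<lambda>i. \<Prod>k=1..n. x k ^ v i k) = 0"
    and j: "j \<in> {1..s}"
  shows "Poly_Mapping.lookup f (Poly_Mapping.single j d) = 0"
proof -
  \<comment> \<open>The exponent of \<open>y\<^sub>k\<close> in the image of the monomial \<open>m\<close>.\<close>
  define e where "e m k = (\<Sum>i\<in>Poly_Mapping.keys m. v i k * Poly_Mapping.lookup m i)" for m k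
  let ?w = "\<lambda>k. v j k * d" and ?p = "Poly_Mapping.single j d"
  let ?F = "{m. m \<in> Poly_Mapping.keys f \<and> (\<forall>k\<in>{1..n}. e m k = ?w k)}"
  have keys: "Poly_Mapping.keys m \<subseteq> {1..s}" and deg: "mdeg m = d"
    if "m \<in> Poly_Mapping.keys f" for m
    using that f by (auto simp: poly_carrier_iff hom_deg_def)
  have "e m k \<le> d" if "m \<in> Poly_Mapping.keys f" "k \<in> {1..n}" for m k
  proof -
    have "e m k \<le> (\<Sum>i\<in>Poly_Mapping.keys m. 1 * Poly_Mapping.lookup m i)"
      unfolding e_def using keys[OF that(1)] that(2) by (intro sum_mono mult_right_mono v01) auto
    then show ?thesis using deg[OF that(1)] by (simp add: mdeg_def)
  qed
  moreover have "(\<Sum>m\<in>Poly_Mapping.keys f. Poly_Mapping.lookup f m * (\<Prod>k=1..n. x k ^ e m k)) = 0"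
    if "\<forall>k\<in>{1..n}. x k \<noteq> 0" for x
  proof -
    have "monom_eval m (\<lambda>i. \<Prod>k=1..n. x k ^ v i k) = (\<Prod>k=1..n. x k ^ e m k)" for m
      unfolding monom_eval_def e_def
      by (simp add: power_sum power_mult prod_power_distrib) (rule prod.swap)
    then show ?thesis
      using vanish[OF that] by (simp add: eval_eq)
  qed
  ultimately have sum0: "(\<Sum>m\<in>?F. Poly_Mapping.lookup f m) = 0"
    using d by (intro reduced_polynomial_vanishing_on_torus) (auto intro: le_less_trans)
  have "m = ?p" if m: "m \<in> ?F" for m
  proof -
    have mf: "m \<in> Poly_Mapping.keys f" using m by simp
    have "i = j" if i: "i \<in> Poly_Mapping.keys m" for i
    proof (rule v_inj)
      show "i \<in> {1..s}" using i keys[OF mf] by blast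
      show "\<forall>k\<in>{1..n}. v i k = v j k"
      proof
        fix k assume k: "k \<in> {1..n}"
        have ek: "e m k = v j k * d" using m k by simp
        have mi: "Poly_Mapping.lookup m i \<noteq> 0" using i by (simp add: in_keys_iff)
        have v1: "v i' k \<le> 1" if "i' \<in> Poly_Mapping.keys m" for i'
          using that keys[OF mf] k v01 by blast
        show "v i k = v j k"
        proof (cases "v j k = 0")
          case True
          then have "v i k * Poly_Mapping.lookup m i = 0"
            using ek i by (simp add: e_def)
          then show ?thesis using mi True by simp
        next
          case False
          then have vj: "v j k = 1" using v01[OF j k] by simp
          \<comment> \<open>The exponent of \<open>y\<^sub>k\<close> is the full degree \<open>d\<close>, so no variable of \<open>m\<close> may lack \<open>y\<^sub>k\<close>.\<close>
          have "e m k + (\<Sum>i\<in>Poly_Mapping.keys m. (1 - v i k) * Poly_Mapping.lookup m i) = mdeg m"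
            unfolding e_def mdeg_def sum.distrib[symmetric]
            by (intro sum.cong refl) (use v1 in \<open>force simp flip: distrib_right\<close>)
          then have "(\<Sum>i\<in>Poly_Mapping.keys m. (1 - v i k) * Poly_Mapping.lookup m i) = 0"
            using ek vj deg[OF mf] by simp
          then have "(1 - v i k) * Poly_Mapping.lookup m i = 0"
            using i by simp
          then show ?thesis using mi vj v1[OF i] by simp
        qed
      qed
    qed (rule j)
    then have "m = Poly_Mapping.single j (Poly_Mapping.lookup m j)"
      by (intro poly_mapping_eqI) (auto simp: lookup_single when_def in_keys_iff)
    with deg[OF mf] show ?thesis by (metis mdeg_single)
  qed
  then have "?F = {} \<or> ?F = {?p}"
    by blast
  then show ?thesis
  proof
    assume *: "?F = {}"
    have "e ?p k = ?w k" for k by (simp add: e_def)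
    with * show ?thesis by (auto simp: in_keys_iff)
  next
    assume "?F = {?p}"
    with sum0 show ?thesis by simp
  qed
qed

section \<open>Comparing generators\<close>

lemma left_inverse_imp_right_inverse_family:
  fixes A G :: "nat \<Rightarrow> nat \<Rightarrow> 'k::field"
  assumes "\<And>i j. i \<in> {1..r} \<Longrightarrow> j \<in> {1..r} \<Longrightarrow> (\<Sum>k=1..r. A i k * G k j) = (if i = j then 1 else 0)"
    and "k \<in> {1..r}" "l \<in> {1..r}"
  shows "(\<Sum>i=1..r. G k i * A i l) = (if k = l then 1 else 0)"
proof -
  define mA where "mA = mat r r (\<lambda>(i, k). A (Suc i) (Suc k))"
  define mG where "mG = mat r r (\<lambda>(i, k). G (Suc i) (Suc k))"
  have shift: "(\<Sum>i=1..r. \<phi> i) = (\<Sum>i=0..<r. \<phi> (Suc i))" for \<phi> :: "nat \<Rightarrow> 'k"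
    by (simp add: sum.atLeast1_atMost_eq atLeast0LessThan)
  have "(\<Sum>k=0..<r. A (Suc i) (Suc k) * G (Suc k) (Suc j)) = (if i = j then 1 else 0)"
    if "i < r" "j < r" for i j
    using assms(1)[of "Suc i" "Suc j"] that by (simp only: shift) simp
  then have "mA * mG = 1\<^sub>m r"
    by (intro eq_matI) (auto simp: mA_def mG_def scalar_prod_def)
  then have "mG * mA = 1\<^sub>m r"
    by (intro mat_mult_left_right_inverse[of mA]) (auto simp: mA_def mG_def)
  then have "(mG * mA) $$ (k - 1, l - 1) = (1\<^sub>m r) $$ (k - 1, l - 1)"
    by simp
  moreover have "(mG * mA) $$ (k - 1, l - 1) = (\<Sum>i=1..r. G k i * A i l)"
    unfolding shift using assms(2,3)
    by (cases k; cases l) (auto simp: mA_def mG_def scalar_prod_def)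
  moreover have "(1\<^sub>m r :: 'k mat) $$ (k - 1, l - 1) = (if k = l then 1 else 0)"
    using assms(2,3) by auto
  ultimately show ?thesis by simp
qed

text \<open>The matrix argument. The hypothesis \<open>dual\<close> says that the \<open>h\<^sub>i\<close> are dual to the pure powers
  \<open>t\<^sub>j\<^sup>N\<close>. It is essential that there are as many generators \<open>g\<^sub>k\<close> as elements \<open>h\<^sub>i\<close>, for only
  then does a one-sided inverse of the coefficient matrix invert it on both sides.\<close>

lemma generators_in_ideal_of_dual_family:
  fixes g h :: "nat \<Rightarrow> 'k::field mpoly"
  assumes g: "\<And>k. k \<in> {1..r} \<Longrightarrow> g k \<in> poly_carrier s" "\<And>k. k \<in> {1..r} \<Longrightarrow> homogeneous (g k)"
    and pure: "\<And>k d j. k \<in> {1..r} \<Longrightarrow> hom_deg d (g k) \<Longrightarrow> d < N \<Longrightarrow> j \<in> {1..r} \<Longrightarrow>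
        Poly_Mapping.lookup (g k) (Poly_Mapping.single j d) = 0"
    and h: "\<And>i. i \<in> {1..r} \<Longrightarrow> h i \<in> genideal (poly_ring s) (g ` {1..r})"
      "\<And>i. i \<in> {1..r} \<Longrightarrow> h i \<in> poly_carrier s"
      "\<And>i. i \<in> {1..r} \<Longrightarrow> hom_deg N (h i)"
    and dual: "\<And>i j. i \<in> {1..r} \<Longrightarrow> j \<in> {1..r} \<Longrightarrow>
        Poly_Mapping.lookup (h i) (Poly_Mapping.single j N) = (if i = j then 1 else 0)"
    and k: "k \<in> {1..r}"
  shows "g k \<in> genideal (poly_ring s) (h ` {1..r})"
proof -
  have "\<forall>k\<in>{1..r}. \<exists>d. hom_deg d (g k)"
    using g(2) by (simp add: homogeneous_iff_hom_deg)
  then obtain \<delta> where \<delta>: "\<And>k. k \<in> {1..r} \<Longrightarrow> hom_deg (\<delta> k) (g k)" by metis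
  have g_sub: "g ` {1..r} \<subseteq> poly_carrier s"
    using g(1) by blast
  have "\<forall>i\<in>{1..r}. \<exists>a. h i = (\<Sum>k=1..r. a k * g k)"
    using genideal_image_combination[OF finite_atLeastAtMost g_sub h(1)] by blast
  then obtain a where a: "\<And>i. i \<in> {1..r} \<Longrightarrow> h i = (\<Sum>k=1..r. a i k * g k)"
    by (auto dest!: bchoice)
  define A where "A i k = Poly_Mapping.lookup (a i k) 0" for i k
  define G where "G k j = Poly_Mapping.lookup (g k) (Poly_Mapping.single j N)" for k j
  have G_0: "G k j = 0" if "k \<in> {1..r}" "\<delta> k \<noteq> N" for k j
    using \<delta>[OF that(1)] that(2) by (metis G_def hom_deg_def in_keys_iff mdeg_single)
  have AG: "(\<Sum>k=1..r. A i k * G k j) = (if i = j then 1 else 0)"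
    if i: "i \<in> {1..r}" and j: "j \<in> {1..r}" for i j
  proof -
    have "Poly_Mapping.lookup (a i k * g k) (Poly_Mapping.single j N) = A i k * G k j"
      if k: "k \<in> {1..r}" for k
    proof (cases "\<delta> k" N rule: linorder_cases)
      case less
      then show ?thesis
        using lookup_mult_pure_power[OF \<delta>[OF k] pure[OF k \<delta>[OF k] less j]] G_0[OF k] by simp
    next
      case equal
      then show ?thesis
        using lookup_mult_same_degree[OF \<delta>[OF k]] by (simp add: A_def G_def)
    next
      case greater
      then show ?thesis
        using lookup_mult_low_degree[OF \<delta>[OF k]] G_0[OF k] by simp
    qed
    then show ?thesis
      using dual[OF i j] a[OF i] by (simp add: lookup_sum)
  qed
  have GA: "(\<Sum>i=1..r. G k i * A i l) = (if k = l then 1 else 0)"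
    if "k \<in> {1..r}" "l \<in> {1..r}" for k l
    using AG that by (rule left_inverse_imp_right_inverse_family)
  \<comment> \<open>A generator of another degree would give a zero row of the invertible matrix \<open>G\<close>.\<close>
  have \<delta>_N: "\<delta> k = N" if "k \<in> {1..r}" for k
  proof (rule ccontr)
    assume "\<delta> k \<noteq> N"
    then show False using GA[OF that that] G_0[OF that] by simp
  qed
  have h_eq: "h i = (\<Sum>l=1..r. Poly_Mapping.single 0 (A i l) * g l)" if i: "i \<in> {1..r}" for i
  proof (rule poly_mapping_eqI)
    fix m
    have "Poly_Mapping.lookup (h i) m = (\<Sum>l=1..r. A i l * Poly_Mapping.lookup (g l) m)"
    proof (cases "mdeg m = N")
      case True
      then have "Poly_Mapping.lookup (a i l * g l) m = A i l * Poly_Mapping.lookup (g l) m"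
        if "l \<in> {1..r}" for l
        using lookup_mult_same_degree[OF \<delta>[OF that]] \<delta>_N[OF that] by (simp add: A_def)
      then show ?thesis by (simp add: a[OF i] lookup_sum)
    next
      case False
      then have "Poly_Mapping.lookup (h i) m = 0"
        using h(3)[OF i] by (auto simp: hom_deg_def in_keys_iff)
      moreover have "Poly_Mapping.lookup (g l) m = 0" if "l \<in> {1..r}" for l
        using \<delta>[OF that] \<delta>_N[OF that] False by (auto simp: hom_deg_def in_keys_iff)
      ultimately show ?thesis by simp
    qed
    then show "Poly_Mapping.lookup (h i) m =
        Poly_Mapping.lookup (\<Sum>l=1..r. Poly_Mapping.single 0 (A i l) * g l) m"
      by (simp add: lookup_sum lookup_const_mult)
  qed
  have "(\<Sum>i=1..r. Poly_Mapping.single 0 (G k i) * h i) = g k"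
  proof (rule poly_mapping_eqI)
    fix m
    have "Poly_Mapping.lookup (\<Sum>i=1..r. Poly_Mapping.single 0 (G k i) * h i) m =
        (\<Sum>i=1..r. \<Sum>l=1..r. G k i * A i l * Poly_Mapping.lookup (g l) m)"
      by (simp add: lookup_sum lookup_const_mult h_eq sum_distrib_left mult.assoc)
    also have "\<dots> = (\<Sum>l=1..r. (\<Sum>i=1..r. G k i * A i l) * Poly_Mapping.lookup (g l) m)"
      by (subst sum.swap) (simp add: sum_distrib_right)
    also have "\<dots> = (\<Sum>l=1..r. (if k = l then 1 else 0) * Poly_Mapping.lookup (g l) m)"
      using GA k by (intro sum.cong) auto
    also have "\<dots> = Poly_Mapping.lookup (g k) m"
      using k by (simp add: if_distrib[of "\<lambda>z. z * _"] sum.delta cong: if_cong)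
    finally show "Poly_Mapping.lookup (\<Sum>i=1..r. Poly_Mapping.single 0 (G k i) * h i) m =
        Poly_Mapping.lookup (g k) m" .
  qed
  moreover have "(\<Sum>i=1..r. Poly_Mapping.single 0 (G k i) * h i) \<in> genideal (poly_ring s) (h ` {1..r})"
  proof (rule ideal_combination_closed)
    have h_sub: "h ` {1..r} \<subseteq> poly_carrier s" using h(2) by blast
    show "ideal (genideal (poly_ring s) (h ` {1..r})) (poly_ring s)"
      using h_sub by (rule ideal_genideal_poly)
    show "h i \<in> genideal (poly_ring s) (h ` {1..r})" if "i \<in> {1..r}" for i
      using ideal_genideal_poly(2)[OF h_sub] that by blast
  qed (rule poly_carrier_const)
  ultimately show ?thesis by simp
qed

section \<open>The vanishing ideal of a toric set\<close>

text \<open>The ideal is generated by homogeneous polynomials that vanish at all representatives of the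
  points; this passes to the ideal because evaluation is a ring homomorphism.\<close>

lemma vanishing_ideal_evaluates_to_zero:
  fixes X :: "(nat \<Rightarrow> 'k::field) set set"
  assumes "f \<in> vanishing_ideal s X" "P \<in> X" "a \<in> P"
  shows "eval f a = 0"
proof -
  let ?I = "{f \<in> poly_carrier s. \<forall>P\<in>X. \<forall>a\<in>P. eval f a = 0}"
  have "ideal ?I (poly_ring s)"
    by (rule poly_ring_idealI) (auto simp: poly_carrier_zero poly_carrier_add poly_carrier_mult eval_add eval_mult)
  then have "vanishing_ideal s X \<subseteq> ?I"
    unfolding vanishing_ideal_def by (rule genideal_minimal_poly) auto
  then show ?thesis using assms by auto
qed

lemma toric_point_mem:
  fixes x :: "nat \<Rightarrow> 'k::field" and v :: "nat \<Rightarrow> nat \<Rightarrow> nat"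
  assumes "s \<ge> 1" "\<forall>k\<in>{1..n}. x k \<noteq> 0"
  defines "a \<equiv> (\<lambda>i. \<Prod>k=1..n. x k ^ v i k)"
  shows "(\<lambda>i\<in>{1..s}. a i) \<in> proj_point s a" "proj_point s a \<in> toric_set n s v"
proof -
  have "(\<lambda>i\<in>{1..s}. a i) \<in> nonzero_vecs s"
    using assms by (auto simp: nonzero_vecs_def a_def intro!: bexI[of _ 1])
  then show "(\<lambda>i\<in>{1..s}. a i) \<in> proj_point s a"
    using equiv_class_self[OF equiv_proj_rel] by (simp add: proj_point_def)
  show "proj_point s a \<in> toric_set n s v"
    using assms(2) by (auto simp: toric_set_def a_def)
qed

lemma toric_set_coordinate_nonzero:
  fixes a :: "nat \<Rightarrow> 'k::field"
  assumes "P \<in> toric_set n s v" "a \<in> P" "i \<in> {1..s}"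
  shows "a i \<noteq> 0"
proof -
  obtain x where "\<forall>k\<in>{1..n}. x k \<noteq> 0" "P = proj_point s (\<lambda>i. \<Prod>k=1..n. x k ^ v i k)"
    using assms(1) by (auto simp: toric_set_def)
  then show ?thesis
    using assms(2,3) by (auto simp: proj_point_def proj_rel_def)
qed

lemma var_power: "var i ^ N = Poly_Mapping.single (Poly_Mapping.single i N) 1"
  by (induction N) (simp_all add: var_def mult_single flip: single_add)

lemma keys_var_power_diff:
  "Poly_Mapping.keys (var i ^ N - var j ^ N) \<subseteq> {Poly_Mapping.single i N, Poly_Mapping.single j N}"
  by (auto simp: in_keys_iff lookup_minus var_power lookup_single when_def split: if_splits)

lemma var_power_diff_carrier:
  assumes "i \<in> {1..s}" "j \<in> {1..s}"
  shows "var i ^ N - var j ^ N \<in> poly_carrier s"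
  unfolding poly_carrier_iff
proof
  fix m assume "m \<in> Poly_Mapping.keys (var i ^ N - var j ^ N :: 'a mpoly)"
  with keys_var_power_diff[of i N j] show "Poly_Mapping.keys m \<subseteq> {1..s}"
    using assms by (auto split: if_splits)
qed

lemma hom_deg_var_power_diff: "hom_deg N (var i ^ N - var j ^ N)"
  using keys_var_power_diff[of i N j] by (auto simp: hom_deg_def)

lemma var_power_diff_in_vanishing_ideal:
  assumes "i \<in> {1..s}" "j \<in> {1..s}"
  shows "var i ^ (CARD('k) - 1) - var j ^ (CARD('k) - 1) \<in>
    vanishing_ideal s (toric_set n s v :: (nat \<Rightarrow> 'k::{field,finite}) set set)"
proof -
  let ?N = "CARD('k) - 1"
  let ?h = "var i ^ ?N - var j ^ ?N :: 'k mpoly"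
  let ?G = "{f \<in> poly_carrier s. homogeneous f \<and>
    (\<forall>P\<in>toric_set n s v. \<forall>a\<in>P. eval f a = (0::'k))}"
  have "eval ?h a = 0" if "P \<in> toric_set n s v" "a \<in> P" for P and a :: "nat \<Rightarrow> 'k"
  proof -
    have "?h = Poly_Mapping.single (Poly_Mapping.single i ?N) 1 + Poly_Mapping.single (Poly_Mapping.single j ?N) (- 1)"
      by (simp add: var_power single_uminus)
    then have "eval ?h a = a i ^ ?N - a j ^ ?N"
      by (simp only: eval_add eval_single) (simp add: monom_eval_def)
    also have "\<dots> = 0"
      using assms[THEN toric_set_coordinate_nonzero[OF that], THEN finite_field_power_eq_1] by simp
    finally show ?thesis .
  qed
  moreover have "?h \<in> poly_carrier s"
    using assms by (rule var_power_diff_carrier)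
  moreover have "homogeneous ?h"
    unfolding homogeneous_iff_hom_deg using hom_deg_var_power_diff by blast
  ultimately have "?h \<in> ?G" by blast
  then show ?thesis
    using ideal_genideal_poly(2)[of ?G s] unfolding vanishing_ideal_def by blast
qed

theorem theorem4p4:
  fixes y :: "nat \<Rightarrow> 'y" and E :: "'y set set" and v :: "nat \<Rightarrow> nat \<Rightarrow> nat"
    and n s q :: nat and X :: "(nat \<Rightarrow> 'k::{field,finite}) set set"
  assumes "q = CARD('k)"
    and "inj_on y {1..n}"
    and "clutter (y ` {1..n}) E"
    and "card E = s" and "s \<ge> 1"
    and "bij_betw v {1..s} (char_vec n y ` E)"
    and "X = toric_set n s v"
    and "complete_intersection s (vanishing_ideal s X)"
  shows "vanishing_ideal s X =
    genideal (poly_ring s) ((\<lambda>i. var i ^ (q - 1) - var s ^ (q - 1)) ` {1..s-1})"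
proof -
  let ?r = "s - 1"
  define N where "N = q - 1"
  define h where "h i = (var i ^ N - var s ^ N :: 'k mpoly)" for i
  obtain g where g: "\<And>k. k \<in> {1..?r} \<Longrightarrow> g k \<in> poly_carrier s" "\<And>k. k \<in> {1..?r} \<Longrightarrow> homogeneous (g k)"
    and I_eq: "vanishing_ideal s X = genideal (poly_ring s) (g ` {1..?r})"
    using assms(8) unfolding complete_intersection_def by blast
  have g_sub: "g ` {1..?r} \<subseteq> poly_carrier s" using g(1) by blast
  have v_char: "v i \<in> char_vec n y ` E" if "i \<in> {1..s}" for i
    using bij_betw_apply[OF assms(6) that] .
  have v01: "v i k \<le> 1" if "i \<in> {1..s}" "k \<in> {1..n}" for i k
    using v_char[OF that(1)] that(2) by (auto simp: char_vec_def)
  \<comment> \<open>Characteristic vectors are fixed outside \<open>{1..n}\<close>, so distinct ones differ inside this range.\<close>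
  have v_inj: "i = j" if "i \<in> {1..s}" "j \<in> {1..s}" "\<forall>k\<in>{1..n}. v i k = v j k" for i j
  proof -
    have "v i = v j"
      using v_char[OF that(1)] v_char[OF that(2)] that(3)
      by (auto simp: char_vec_def restrict_def fun_eq_iff split: if_splits)
    then show ?thesis
      using that(1,2) bij_betw_imp_inj_on[OF assms(6)] by (auto dest: inj_onD)
  qed
  have pure: "Poly_Mapping.lookup f (Poly_Mapping.single j d) = 0"
    if f: "f \<in> poly_carrier s" "f \<in> vanishing_ideal s X" "hom_deg d f" and "d < N" "j \<in> {1..s}" for f d j
  proof -
    have d: "d < CARD('k) - 1" using that(4) assms(1) by (simp add: N_def)
    have vanish: "eval f (\<lambda>i. \<Prod>k=1..n. x k ^ v i k) = 0"
      if x: "\<forall>k\<in>{1..n}. x k \<noteq> 0" for x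
      using vanishing_ideal_evaluates_to_zero[OF f(2) _ toric_point_mem(1)[OF assms(5) x]]
        toric_point_mem(2)[OF assms(5) x]
        eval_cong[OF f(1), of "\<lambda>i\<in>{1..s}. \<Prod>k=1..n. x k ^ v i k" "\<lambda>i. \<Prod>k=1..n. x k ^ v i k"]
      by (simp add: assms(7))
    show ?thesis
      by (rule no_pure_power_low_degree[OF f(1,3) d v01 v_inj vanish that(5)])
  qed
  have h_I: "h i \<in> vanishing_ideal s X" if "i \<in> {1..?r}" for i
    using that var_power_diff_in_vanishing_ideal[of i s s, where ?'k = 'k]
    by (auto simp: h_def N_def assms(1,7))
  \<comment> \<open>For \<open>N = 0\<close> all pure powers would coincide, and the \<open>h\<^sub>i\<close> would not be dual to them.\<close>
  have N_pos: "N > 0"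
    using card_mono[of "UNIV :: 'k set" "{0, 1}"] assms(1) by (simp add: N_def)
  have h_carrier: "h i \<in> poly_carrier s" if "i \<in> {1..?r}" for i
    unfolding h_def using that by (intro var_power_diff_carrier) auto
  have h_hom: "hom_deg N (h i)" for i
    unfolding h_def by (rule hom_deg_var_power_diff)
  have single_eq: "Poly_Mapping.single i N = Poly_Mapping.single j N \<longleftrightarrow> i = j" for i j :: nat
    using N_pos by (metis keys_single neq0_conv singleton_inject)
  have h_dual: "Poly_Mapping.lookup (h i) (Poly_Mapping.single j N) = (if i = j then 1 else 0)"
    if "i \<in> {1..?r}" "j \<in> {1..?r}" for i j
    using that by (auto simp: h_def lookup_minus var_power lookup_single when_def single_eq)
  have gens: "g k \<in> vanishing_ideal s X" if "k \<in> {1..?r}" for k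
    using ideal_genideal_poly(2)[OF g_sub] that by (auto simp: I_eq)
  have "vanishing_ideal s X = genideal (poly_ring s) (h ` {1..?r})"
  proof
    have "g k \<in> genideal (poly_ring s) (h ` {1..?r})" if "k \<in> {1..?r}" for k
      by (rule generators_in_ideal_of_dual_family[where g = g and N = N])
        (use that g h_I h_carrier h_hom h_dual pure gens I_eq in auto)
    then show "vanishing_ideal s X \<subseteq> genideal (poly_ring s) (h ` {1..?r})"
      unfolding I_eq using h_carrier
      by (intro genideal_minimal_poly ideal_genideal_poly) auto
    show "genideal (poly_ring s) (h ` {1..?r}) \<subseteq> vanishing_ideal s X"
      using h_I ideal_genideal_poly(1)[OF g_sub] by (intro genideal_minimal_poly) (auto simp: I_eq)
  qed
  then show ?thesis by (simp add: h_def[abs_def] N_def)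
qed

end
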